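(* Let $X$ be a countably infinite set. The lattice $\mathrm{Cl}_{loc}(X)$ is not embeddable (as a lattice) into any algebraic lattice with countably many compact elements.
   Context: For $n\ge 1$, let $\mathscr O^{(n)}=X^{X^n}$ be the set of $n$-ary operations on $X$ and $\mathscr O=\bigcup_{n\ge1}\mathscr O^{(n)}$. A clone on $X$ is a subset of $\mathscr O$ that contains all projections $\pi^n_k(x_1,\dots,x_n)=x_k$ ($1\le k\le n$) and is closed under composition: if $f$ is an $n$-ary member and $g_1,\dots,g_n$ are $m$-ary members, then $f(g_1,\dots,g_n)$ is a member. Equip $X$ with the discrete topology and each $\mathscr O^{(n)}=X^{X^n}$ with the product topology. A clone $\mathscr C$ is local (locally closed) iff $\mathscr C\cap\mathscr O^{(n)}$ is closed in $\mathscr O^{(n)}$ for every $n\ge1$. $\mathrm{Cl}_{loc}(X)$ is the complete lattice of all local clones on $X$ ordered by inclusion. *)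

theory Defs
  imports "HOL-Algebra.Complete_Lattice" "HOL-Analysis.Function_Topology"
begin

text \<open>
  An \<open>n\<close>-tuple over \<open>X\<close> is an extensional function on the indices \<open>0, \<dots>, n - 1\<close>, and an
  \<open>n\<close>-ary operation is an extensional function on the set of these tuples.  Extensionality
  makes equality of operations agree with equality on \<open>X\<^sup>n\<close>.
\<close>

definition tuples :: "'a set \<Rightarrow> nat \<Rightarrow> (nat \<Rightarrow> 'a) set" where
  "tuples X n = PiE {..<n} (\<lambda>_. X)"

definition ops :: "'a set \<Rightarrow> nat \<Rightarrow> ((nat \<Rightarrow> 'a) \<Rightarrow> 'a) set" where
  "ops X n = PiE (tuples X n) (\<lambda>_. X)"

definition ops_topology :: "'a set \<Rightarrow> nat \<Rightarrow> ((nat \<Rightarrow> 'a) \<Rightarrow> 'a) topology" where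
  "ops_topology X n = product_topology (\<lambda>_. discrete_topology X) (tuples X n)"

text \<open>
  Operations carry their arity as a tag: the constant operation with value \<open>undefined\<close> is the
  same HOL function in every arity.
\<close>

type_synonym 'a operation = "nat \<times> ((nat \<Rightarrow> 'a) \<Rightarrow> 'a)"

definition all_ops :: "'a set \<Rightarrow> 'a operation set" where
  "all_ops X = (SIGMA n:{1..}. ops X n)"

definition proj_op :: "'a set \<Rightarrow> nat \<Rightarrow> nat \<Rightarrow> (nat \<Rightarrow> 'a) \<Rightarrow> 'a" where
  "proj_op X n k = (\<lambda>x\<in>tuples X n. x k)"

definition comp_op ::
  "'a set \<Rightarrow> nat \<Rightarrow> nat \<Rightarrow> ((nat \<Rightarrow> 'a) \<Rightarrow> 'a) \<Rightarrow> (nat \<Rightarrow> (nat \<Rightarrow> 'a) \<Rightarrow> 'a) \<Rightarrow> (nat \<Rightarrow> 'a) \<Rightarrow> 'a"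
where
  "comp_op X n m f g = (\<lambda>x\<in>tuples X m. f (\<lambda>i\<in>{..<n}. g i x))"

definition is_clone :: "'a set \<Rightarrow> 'a operation set \<Rightarrow> bool" where
  "is_clone X C \<longleftrightarrow>
     C \<subseteq> all_ops X \<and>
     (\<forall>n\<ge>1. \<forall>k<n. (n, proj_op X n k) \<in> C) \<and>
     (\<forall>n\<ge>1. \<forall>m\<ge>1. \<forall>f g. (n, f) \<in> C \<and> (\<forall>i<n. (m, g i) \<in> C) \<longrightarrow> (m, comp_op X n m f g) \<in> C)"

definition is_local_clone :: "'a set \<Rightarrow> 'a operation set \<Rightarrow> bool" where
  "is_local_clone X C \<longleftrightarrow>
     is_clone X C \<and> (\<forall>n\<ge>1. closedin (ops_topology X n) {f. (n, f) \<in> C})"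

definition Cl_loc :: "'a set \<Rightarrow> 'a operation set gorder" where
  "Cl_loc X = \<lparr>carrier = {C. is_local_clone X C}, eq = (=), le = (\<subseteq>)\<rparr>"

lemma topspace_ops_topology: "topspace (ops_topology X n) = ops X n"
  by (simp add: ops_topology_def ops_def)

lemma is_local_clone_all_ops: "is_local_clone X (all_ops X)"
proof -
  have "proj_op X n k \<in> ops X n" if "k < n" for n k
    using that by (auto simp: proj_op_def ops_def tuples_def)
  moreover have "comp_op X n m f g \<in> ops X m"
    if "f \<in> ops X n" "\<forall>i<n. g i \<in> ops X m" for n m f g
  proof -
    have "(\<lambda>i\<in>{..<n}. g i x) \<in> tuples X n" if "x \<in> tuples X m" for x
      using \<open>\<forall>i<n. g i \<in> ops X m\<close> that by (auto simp: ops_def tuples_def)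
    with \<open>f \<in> ops X n\<close> show ?thesis
      by (auto simp: comp_op_def ops_def)
  qed
  moreover have "closedin (ops_topology X n) {f. (n, f) \<in> all_ops X}" if "n \<ge> 1" for n
    using that closedin_topspace[of "ops_topology X n"]
    by (simp add: all_ops_def topspace_ops_topology)
  ultimately show ?thesis
    by (simp add: is_local_clone_def is_clone_def all_ops_def)
qed

lemma is_local_clone_Inter:
  assumes "\<A> \<noteq> {}" "\<And>C. C \<in> \<A> \<Longrightarrow> is_local_clone X C"
  shows "is_local_clone X (\<Inter>\<A>)"
proof -
  have "closedin (ops_topology X n) {f. (n, f) \<in> \<Inter>\<A>}" if "n \<ge> 1" for n
  proof -
    have "{f. (n, f) \<in> \<Inter>\<A>} = (\<Inter>C\<in>\<A>. {f. (n, f) \<in> C})"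
      by auto
    then show ?thesis
      using assms that by (auto simp: is_local_clone_def intro!: closedin_INT)
  qed
  moreover have "is_clone X (\<Inter>\<A>)"
    unfolding is_clone_def
  proof (intro conjI allI impI)
    show "\<Inter>\<A> \<subseteq> all_ops X"
      using assms unfolding is_local_clone_def is_clone_def by blast
  qed (use assms(2) in \<open>auto simp: is_local_clone_def is_clone_def\<close>)
  ultimately show ?thesis
    by (simp add: is_local_clone_def)
qed

lemma complete_lattice_Cl_loc: "complete_lattice (Cl_loc X)"
proof -
  interpret partial_order "Cl_loc X"
    by unfold_locales (auto simp: Cl_loc_def)
  show ?thesis
  proof (rule complete_lattice_criterion1)
    show "\<exists>g. greatest (Cl_loc X) g (carrier (Cl_loc X))"
      using is_local_clone_all_ops[of X]
      by (intro exI[of _ "all_ops X"])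
        (auto simp: greatest_def Cl_loc_def is_local_clone_def is_clone_def)
  next
    fix A assume "A \<subseteq> carrier (Cl_loc X)" "A \<noteq> {}"
    then show "\<exists>i. greatest (Cl_loc X) i (Lower (Cl_loc X) A)"
      using is_local_clone_Inter[of A X]
      by (intro exI[of _ "\<Inter>A"]) (auto simp: greatest_def Lower_def Cl_loc_def)
  qed
qed

definition compact_element :: "('b, 'c) gorder_scheme \<Rightarrow> 'b \<Rightarrow> bool" where
  "compact_element L k \<longleftrightarrow>
     k \<in> carrier L \<and>
     (\<forall>A \<subseteq> carrier L. k \<sqsubseteq>\<^bsub>L\<^esub> \<Squnion>\<^bsub>L\<^esub>A \<longrightarrow> (\<exists>B \<subseteq> A. finite B \<and> k \<sqsubseteq>\<^bsub>L\<^esub> \<Squnion>\<^bsub>L\<^esub>B))"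

locale algebraic_lattice = complete_lattice +
  assumes sup_of_compact:
    "x \<in> carrier L \<Longrightarrow> \<exists>K. (\<forall>k\<in>K. compact_element L k) \<and> x = \<Squnion>\<^bsub>L\<^esub>K"

text \<open>
  \<open>join_pres\<close> and \<open>meet_pres\<close> also require both structures to be lattices; for \<open>Cl_loc X\<close> this
  follows from \<open>complete_lattice_Cl_loc\<close>, so it does not restrict embeddings out of \<open>Cl_loc X\<close>.
\<close>

definition lattice_embedding ::
  "('a, 'c) gorder_scheme \<Rightarrow> ('b, 'd) gorder_scheme \<Rightarrow> ('a \<Rightarrow> 'b) \<Rightarrow> bool"
where
  "lattice_embedding L M h \<longleftrightarrow>
     h \<in> carrier L \<rightarrow> carrier M \<and> inj_on h (carrier L) \<and>
     join_pres L M h \<and> meet_pres L M h"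

end

theory Submission
  imports Defs "HOL-Analysis.T1_Spaces" "HOL-Library.Equipollence"
begin

text \<open>
  The obstruction is a counting argument about meets.  Suppose that the elements
  \<open>a\<^sub>i\<close> (\<open>i \<in> I\<close>) of an algebraic lattice do not lie below \<open>z\<close>, while any two of them have their
  meet below \<open>z\<close>.  Every \<open>a\<^sub>i\<close> is a join of compact elements, so one of these compact elements,
  say \<open>c\<^sub>i\<close>, is not below \<open>z\<close>.  If \<open>c\<^sub>i = c\<^sub>j\<close> with \<open>i \<noteq> j\<close>, this element would lie below both
  \<open>a\<^sub>i\<close> and \<open>a\<^sub>j\<close>, hence below their meet and below \<open>z\<close>.  So the map
  \<open>i \<mapsto> c\<^sub>i\<close> is injective, and there are at least as many compact elements as indices
  (\<open>countable_index_if_meets_below\<close>).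

  It remains to find uncountably many local clones that properly contain the clone of
  projections and meet pairwise in it.  Operations that depend on a single variable suffice: a
  monoid of self-maps of \<open>X\<close> becomes a clone by letting its members act on any one variable,
  the clones of two monoids meet in the clone of the common submonoid (\<open>unary_clone_Int\<close>),
  and the clone of a finite monoid is closed because it has only finitely many members of each
  arity (\<open>is_local_clone_unary_clone\<close>).  Every idempotent map \<open>f\<close> gives the two-element monoid
  \<open>{id, f}\<close>, and there are uncountably many idempotent maps: fix a point \<open>p\<close> of \<open>X\<close> and collapse
  an arbitrary nonempty set of other points to \<open>p\<close>.
\<close>

section \<open>Meets in algebraic lattices\<close>

lemma (in algebraic_lattice) compact_element_separates:
  assumes "a \<in> carrier L" "z \<in> carrier L" "\<not> a \<sqsubseteq> z"
  obtains c where "compact_element L c" "c \<sqsubseteq> a" "\<not> c \<sqsubseteq> z"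
proof -
  obtain K where K: "\<forall>k\<in>K. compact_element L k" and a: "a = \<Squnion>K"
    using sup_of_compact[OF assms(1)] by blast
  have sub: "K \<subseteq> carrier L"
    using K by (auto simp: compact_element_def)
  obtain c where "c \<in> K" "\<not> c \<sqsubseteq> z"
    using sup_least[OF sub assms(2)] assms(3) a by auto
  moreover have "c \<sqsubseteq> a" if "c \<in> K" for c
    unfolding a using that by (rule sup_upper[OF sub])
  ultimately show ?thesis
    using that K by blast
qed

lemma (in algebraic_lattice) countable_index_if_meets_below:
  assumes countable: "countable {k. compact_element L k}"
    and z: "z \<in> carrier L"
    and a: "\<And>i. i \<in> I \<Longrightarrow> a i \<in> carrier L"
    and not_below: "\<And>i. i \<in> I \<Longrightarrow> \<not> a i \<sqsubseteq> z"
    and meet_below: "\<And>i j. \<lbrakk>i \<in> I; j \<in> I; i \<noteq> j\<rbrakk> \<Longrightarrow> a i \<sqinter> a j \<sqsubseteq> z"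
  shows "countable I"
proof -
  have "\<forall>i\<in>I. \<exists>c. compact_element L c \<and> c \<sqsubseteq> a i \<and> \<not> c \<sqsubseteq> z"
    using compact_element_separates a not_below z by metis
  then obtain c where c: "\<And>i. i \<in> I \<Longrightarrow> compact_element L (c i)"
      "\<And>i. i \<in> I \<Longrightarrow> c i \<sqsubseteq> a i" "\<And>i. i \<in> I \<Longrightarrow> \<not> c i \<sqsubseteq> z"
    by metis
  have "inj_on c I"
  proof (rule inj_onI, rule ccontr)
    fix i j assume ij: "i \<in> I" "j \<in> I" "c i = c j" "i \<noteq> j"
    have ci: "c i \<in> carrier L"
      using c(1) ij by (auto simp: compact_element_def)
    have "c i \<sqsubseteq> a i \<sqinter> a j"
      using ij a c(2) ci by (metis meet_le)
    then have "c i \<sqsubseteq> z"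
      using meet_below[of i j] ij a z ci by (meson le_trans meet_closed)
    then show False
      using c(3) ij by blast
  qed
  moreover have "countable (c ` I)"
    using c(1) by (auto intro: countable_subset[OF _ countable])
  ultimately show ?thesis
    using countable_image_inj_on by blast
qed

section \<open>Clones of essentially unary operations\<close>

definition unary_op :: "'a set \<Rightarrow> nat \<Rightarrow> nat \<Rightarrow> ('a \<Rightarrow> 'a) \<Rightarrow> (nat \<Rightarrow> 'a) \<Rightarrow> 'a" where
  "unary_op X n k g = (\<lambda>x\<in>tuples X n. g (x k))"

definition unary_clone :: "'a set \<Rightarrow> ('a \<Rightarrow> 'a) set \<Rightarrow> 'a operation set" where
  "unary_clone X M = {(n, unary_op X n k g) |n k g. k < n \<and> g \<in> M}"

lemma tuples_apply: "\<lbrakk>x \<in> tuples X n; k < n\<rbrakk> \<Longrightarrow> x k \<in> X"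
  by (auto simp: tuples_def)

lemma unary_op_in_ops: "\<lbrakk>g \<in> X \<rightarrow>\<^sub>E X; k < n\<rbrakk> \<Longrightarrow> unary_op X n k g \<in> ops X n"
  by (auto simp: unary_op_def ops_def dest: tuples_apply)

lemma proj_op_eq_unary_op: "k < n \<Longrightarrow> proj_op X n k = unary_op X n k (\<lambda>x\<in>X. x)"
  by (auto simp: proj_op_def unary_op_def fun_eq_iff dest: tuples_apply)

text \<open>
  Evaluation at constant tuples recovers the self-map, whichever variable it acts on.
\<close>

lemma unary_op_inject:
  assumes "unary_op X n k f = unary_op X n l g" "k < n" "l < n"
    and "f \<in> X \<rightarrow>\<^sub>E X" "g \<in> X \<rightarrow>\<^sub>E X"
  shows "f = g"
proof (rule PiE_ext[OF assms(4,5)])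
  fix a assume "a \<in> X"
  then have "(\<lambda>i\<in>{..<n}. a) \<in> tuples X n"
    by (auto simp: tuples_def)
  then show "f a = g a"
    using fun_cong[OF assms(1), of "\<lambda>i\<in>{..<n}. a"] assms(2,3) by (simp add: unary_op_def)
qed

lemma unary_clone_memE:
  assumes "(n, h) \<in> unary_clone X M"
  obtains k g where "h = unary_op X n k g" "k < n" "g \<in> M"
  using assms by (auto simp: unary_clone_def)

lemma unary_clone_memI: "\<lbrakk>k < n; g \<in> M\<rbrakk> \<Longrightarrow> (n, unary_op X n k g) \<in> unary_clone X M"
  by (auto simp: unary_clone_def)

lemma unary_clone_mem_ops:
  assumes "(n, h) \<in> unary_clone X M" "M \<subseteq> X \<rightarrow>\<^sub>E X"
  shows "h \<in> ops X n" "1 \<le> n"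
proof -
  obtain k g where "h = unary_op X n k g" "k < n" "g \<in> M"
    using assms(1) by (rule unary_clone_memE)
  then show "h \<in> ops X n" "1 \<le> n"
    using assms(2) unary_op_in_ops[of g X k n] by auto
qed

lemma unary_clone_Int:
  assumes "M \<subseteq> X \<rightarrow>\<^sub>E X" "N \<subseteq> X \<rightarrow>\<^sub>E X"
  shows "unary_clone X M \<inter> unary_clone X N = unary_clone X (M \<inter> N)"
proof
  show "unary_clone X M \<inter> unary_clone X N \<subseteq> unary_clone X (M \<inter> N)"
  proof clarify
    fix n h assume hM: "(n, h) \<in> unary_clone X M" and hN: "(n, h) \<in> unary_clone X N"
    obtain k f where f: "h = unary_op X n k f" "k < n" "f \<in> M"
      using hM by (rule unary_clone_memE)
    obtain l g where g: "h = unary_op X n l g" "l < n" "g \<in> N"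
      using hN by (rule unary_clone_memE)
    have "f = g"
      using unary_op_inject[of X n k f l g] f g assms by blast
    with f g show "(n, h) \<in> unary_clone X (M \<inter> N)"
      by (auto intro: unary_clone_memI)
  qed
qed (auto simp: unary_clone_def)

lemma unary_clone_subset_imp_subset:
  assumes "unary_clone X M \<subseteq> unary_clone X N" "M \<subseteq> X \<rightarrow>\<^sub>E X" "N \<subseteq> X \<rightarrow>\<^sub>E X"
  shows "M \<subseteq> N"
proof
  fix f assume f: "f \<in> M"
  then have "(1, unary_op X 1 0 f) \<in> unary_clone X N"
    using assms(1) unary_clone_memI[of 0 1 f M X] by auto
  then obtain g where "g \<in> N" "unary_op X 1 0 f = unary_op X 1 0 g"
    by (auto simp: unary_clone_def)
  then show "f \<in> N"
    using unary_op_inject[of X 1 0 f 0 g] f assms(2,3) by auto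
qed

lemma comp_op_unary_op:
  assumes "k < n" "\<And>i. i < n \<Longrightarrow> h i \<in> ops X m" "h k = unary_op X m l g"
    and "l < m"
  shows "comp_op X n m (unary_op X n k f) h = unary_op X m l (compose X f g)"
proof
  fix x
  show "comp_op X n m (unary_op X n k f) h x = unary_op X m l (compose X f g) x"
  proof (cases "x \<in> tuples X m")
    case True
    then have "(\<lambda>i\<in>{..<n}. h i x) \<in> tuples X n"
      using assms(2) by (auto simp: tuples_def ops_def)
    then show ?thesis
      using True assms tuples_apply[OF True \<open>l < m\<close>]
      by (simp add: comp_op_def unary_op_def compose_def)
  qed (simp add: comp_op_def unary_op_def)
qed

lemma is_clone_unary_clone:
  assumes "M \<subseteq> X \<rightarrow>\<^sub>E X" "(\<lambda>x\<in>X. x) \<in> M"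
    and closed: "\<And>f g. \<lbrakk>f \<in> M; g \<in> M\<rbrakk> \<Longrightarrow> compose X f g \<in> M"
  shows "is_clone X (unary_clone X M)"
  unfolding is_clone_def
proof (intro conjI allI impI)
  show sub: "unary_clone X M \<subseteq> all_ops X"
    using unary_clone_mem_ops assms(1) by (auto simp: all_ops_def)
  show "(n, proj_op X n k) \<in> unary_clone X M" if "k < n" for n k
    using that assms(2) by (simp add: proj_op_eq_unary_op unary_clone_memI)
  fix n m f h
  assume *: "(n, f) \<in> unary_clone X M \<and> (\<forall>i<n. (m, h i) \<in> unary_clone X M)"
  then obtain k f' where f: "f = unary_op X n k f'" "k < n" "f' \<in> M"
    using unary_clone_memE by blast
  with * have "(m, h k) \<in> unary_clone X M"
    by blast
  then obtain l g where g: "h k = unary_op X m l g" "l < m" "g \<in> M"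
    by (rule unary_clone_memE)
  have "h i \<in> ops X m" if "i < n" for i
    using * that unary_clone_mem_ops(1)[OF _ assms(1)] by blast
  then have "comp_op X n m f h = unary_op X m l (compose X f' g)"
    unfolding f(1) by (intro comp_op_unary_op f g)
  then show "(m, comp_op X n m f h) \<in> unary_clone X M"
    using closed[OF f(3) g(3)] g(2) by (simp add: unary_clone_memI)
qed

text \<open>
  A product of discrete spaces is a \<open>T\<^sub>1\<close> space, so a clone with only finitely many
  members of each arity is closed.
\<close>

lemma is_local_clone_unary_clone:
  assumes "finite M" "M \<subseteq> X \<rightarrow>\<^sub>E X" "(\<lambda>x\<in>X. x) \<in> M"
    and "\<And>f g. \<lbrakk>f \<in> M; g \<in> M\<rbrakk> \<Longrightarrow> compose X f g \<in> M"
  shows "is_local_clone X (unary_clone X M)"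
proof -
  have "closedin (ops_topology X n) {f. (n, f) \<in> unary_clone X M}" for n
  proof -
    have eq: "{f. (n, f) \<in> unary_clone X M} = (\<lambda>(k, g). unary_op X n k g) ` ({..<n} \<times> M)"
      by (auto simp: unary_clone_def)
    have "t1_space (ops_topology X n)"
      by (simp add: ops_topology_def t1_space_product_topology Hausdorff_imp_t1_space)
    moreover have "{f. (n, f) \<in> unary_clone X M} \<subseteq> topspace (ops_topology X n)"
      unfolding topspace_ops_topology
      using unary_clone_mem_ops(1)[OF _ assms(2)] by blast
    moreover have "finite {f. (n, f) \<in> unary_clone X M}"
      unfolding eq using assms(1) by simp
    ultimately show ?thesis
      using t1_space_closedin_finite by blast
  qed
  then show ?thesis
    using is_clone_unary_clone[OF assms(2-4)] by (simp add: is_local_clone_def)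
qed

lemma meet_Cl_loc:
  assumes "is_local_clone X C" "is_local_clone X D"
  shows "C \<sqinter>\<^bsub>Cl_loc X\<^esub> D = C \<inter> D"
proof -
  interpret complete_lattice "Cl_loc X"
    by (rule complete_lattice_Cl_loc)
  have CD: "C \<in> carrier (Cl_loc X)" "D \<in> carrier (Cl_loc X)"
    using assms by (auto simp: Cl_loc_def)
  have Int: "C \<inter> D \<in> carrier (Cl_loc X)"
    using is_local_clone_Inter[of "{C, D}" X] assms by (auto simp: Cl_loc_def)
  have "C \<inter> D \<subseteq> C \<sqinter>\<^bsub>Cl_loc X\<^esub> D"
    using meet_le[OF _ _ CD Int] by (simp add: Cl_loc_def)
  moreover have "C \<sqinter>\<^bsub>Cl_loc X\<^esub> D \<subseteq> C \<inter> D"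
    using meet_left[OF CD] meet_right[OF CD] by (simp add: Cl_loc_def)
  ultimately show ?thesis
    by blast
qed

section \<open>Uncountably many idempotent maps\<close>

definition collapse :: "'a set \<Rightarrow> 'a \<Rightarrow> 'a set \<Rightarrow> 'a \<Rightarrow> 'a" where
  "collapse X p S = (\<lambda>x\<in>X. if x \<in> S then p else x)"

lemma collapse_in_funcset: "p \<in> X \<Longrightarrow> collapse X p S \<in> X \<rightarrow>\<^sub>E X"
  by (auto simp: collapse_def)

lemma collapse_empty: "collapse X p {} = (\<lambda>x\<in>X. x)"
  by (simp add: collapse_def)

lemma compose_collapse:
  assumes "p \<in> X" "p \<notin> S"
  shows "compose X (collapse X p S) (collapse X p S) = collapse X p S"
  using assms by (auto simp: compose_def collapse_def fun_eq_iff)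

text \<open>
  The collapsed set consists of the points other than \<open>p\<close> that are sent to \<open>p\<close>.
\<close>

lemma inj_on_collapse: "inj_on (collapse X p) (Pow (X - {p}))"
proof (rule inj_on_inverseI)
  fix S assume "S \<in> Pow (X - {p})"
  then show "{x \<in> X - {p}. collapse X p S x = p} = S"
    by (auto simp: collapse_def split: if_splits)
qed

lemma is_local_clone_collapse:
  assumes "p \<in> X" "p \<notin> S"
  shows "is_local_clone X (unary_clone X {\<lambda>x\<in>X. x, collapse X p S})"
proof (rule is_local_clone_unary_clone)
  have "compose X (\<lambda>x\<in>X. x) f = f" "compose X f (\<lambda>x\<in>X. x) = f" if "f \<in> X \<rightarrow>\<^sub>E X" for f
    using that by (auto simp: compose_def fun_eq_iff PiE_def extensional_def)
  then show "compose X f g \<in> {\<lambda>x\<in>X. x, collapse X p S}"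
    if "f \<in> {\<lambda>x\<in>X. x, collapse X p S}" "g \<in> {\<lambda>x\<in>X. x, collapse X p S}" for f g
    using that compose_collapse[OF assms] collapse_in_funcset[OF assms(1)] by auto
qed (use collapse_in_funcset[OF assms(1)] in auto)

lemma uncountable_Pow:
  assumes "infinite A"
  shows "uncountable (Pow A)"
proof
  assume "countable (Pow A)"
  then have "Pow A \<lesssim> (UNIV :: nat set)"
    by (auto simp: countable_def lepoll_def)
  moreover have "(UNIV :: nat set) \<lesssim> A"
    using assms by (simp add: infinite_le_lepoll)
  ultimately show False
    using lesspoll_Pow_self[of A] by (meson lepoll_antisym lepoll_trans lesspoll_def)
qed

section \<open>No embedding\<close>

theorem corollary13:
  fixes X :: "'a set" and L :: "('b, 'c) gorder_scheme"
  assumes "countable X" and "infinite X"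
    and "algebraic_lattice L" and "countable {k. compact_element L k}"
  shows "\<not> (\<exists>h. lattice_embedding (Cl_loc X) L h)"
proof
  assume "\<exists>h. lattice_embedding (Cl_loc X) L h"
  then obtain h where h: "h \<in> carrier (Cl_loc X) \<rightarrow> carrier L" "inj_on h (carrier (Cl_loc X))"
    and meet_pres: "meet_pres (Cl_loc X) L h"
    by (auto simp: lattice_embedding_def)
  have carrier: "C \<in> carrier (Cl_loc X) \<longleftrightarrow> is_local_clone X C" for C
    by (simp add: Cl_loc_def)
  have meet: "h (C \<inter> D) = h C \<sqinter>\<^bsub>L\<^esub> h D" if "is_local_clone X C" "is_local_clone X D" for C D
    using meet_pres that by (simp add: meet_pres_def carrier flip: meet_Cl_loc)
  interpret algebraic_lattice L
    by fact
  obtain p where p: "p \<in> X"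
    using assms(2) by fastforce
  define M where "M S = {\<lambda>x\<in>X. x, collapse X p S}" for S
  define C where "C S = unary_clone X (M S)" for S
  define I where "I = Pow (X - {p}) - {{}}"
  have M_sub: "M S \<subseteq> X \<rightarrow>\<^sub>E X" for S
    using collapse_in_funcset[OF p] by (auto simp: M_def)
  have local: "is_local_clone X (C S)" if "S \<in> Pow (X - {p})" for S
    using that is_local_clone_collapse[OF p] by (auto simp: C_def M_def)
  have closed: "h (C S) \<in> carrier L" if "S \<in> Pow (X - {p})" for S
    using local[OF that] h(1) by (auto simp: carrier)
  have Int: "C S \<inter> C T = C {}" if "S \<in> Pow (X - {p})" "T \<in> Pow (X - {p})" "S \<noteq> T" for S T
  proof -
    have "collapse X p S \<noteq> collapse X p T"
      using inj_on_collapse[of X p] that by (auto dest: inj_onD)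
    then have "M S \<inter> M T = M {}"
      by (auto simp: M_def collapse_empty)
    then show ?thesis
      using unary_clone_Int[OF M_sub M_sub] by (simp add: C_def)
  qed
  have "countable I"
  proof (rule countable_index_if_meets_below[OF assms(4)])
    show "h (C {}) \<in> carrier L"
      by (simp add: closed)
    show "h (C S) \<in> carrier L" if "S \<in> I" for S
      using that closed by (simp add: I_def)
    show "h (C S) \<sqinter>\<^bsub>L\<^esub> h (C T) \<sqsubseteq>\<^bsub>L\<^esub> h (C {})" if "S \<in> I" "T \<in> I" "S \<noteq> T" for S T
      using that Int[of S T] meet[OF local local, of S T] closed[of "{}"] by (simp add: I_def)
    show "\<not> h (C S) \<sqsubseteq>\<^bsub>L\<^esub> h (C {})" if "S \<in> I" for S
    proof
      have S: "S \<in> Pow (X - {p})" "S \<noteq> {}"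
        using that by (auto simp: I_def)
      \<comment> \<open>An embedding reflects the order: \<open>a \<sqsubseteq> b\<close> says that \<open>a\<close> is the meet of \<open>a\<close> and \<open>b\<close>.\<close>
      assume below: "h (C S) \<sqsubseteq>\<^bsub>L\<^esub> h (C {})"
      have "h (C S) \<sqsubseteq>\<^bsub>L\<^esub> h (C S) \<sqinter>\<^bsub>L\<^esub> h (C {})"
        using below closed S(1) by (intro meet_le) auto
      then have "h (C S) \<sqsubseteq>\<^bsub>L\<^esub> h (C {})" "h (C {}) \<sqsubseteq>\<^bsub>L\<^esub> h (C S)"
        using below meet[OF local local, of S "{}"] Int[of S "{}"] S
          meet_left[OF closed closed, of S "{}"] by auto
      then have "h (C S) = h (C {})"
        using closed S(1) by (intro le_antisym) auto
      then have "C S = C {}"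
        using inj_onD[OF h(2)] local S(1) by (simp add: carrier)
      then have "M S \<subseteq> M {}"
        using unary_clone_subset_imp_subset[OF _ M_sub M_sub] by (simp add: C_def)
      then have "collapse X p S = collapse X p {}"
        by (auto simp: M_def collapse_empty)
      then show False
        using inj_onD[OF inj_on_collapse, of X p S "{}"] S by auto
    qed
  qed
  then have "countable (Pow (X - {p}))"
    by (simp add: I_def)
  then show False
    using uncountable_Pow[of "X - {p}"] assms(2) by simp
qed

end
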